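(* $R_1^{\Delta}(4,4)=6$, and up to isomorphism the unique extremal graph is the cycle $C_5$. That is, every triangle-free graph on $6$ vertices contains a $1$-dense set of $4$ vertices or a $1$-sparse set of $4$ vertices, and $C_5$ is, up to isomorphism, the only triangle-free graph on $5$ vertices containing neither.
   Context: All graphs are finite and simple. For an integer $k\ge0$, a set $S$ of vertices of a graph $G$ is $k$-sparse if the induced subgraph $G[S]$ has maximum degree at most $k$, and $k$-dense if every vertex of $S$ is non-adjacent to at most $k$ other vertices of $S$. $R_k^{\Delta}(i,j)$ denotes the least $n$ such that every triangle-free graph on $n$ vertices contains a $k$-dense set of $i$ vertices or a $k$-sparse set of $j$ vertices. An extremal graph for $R_k^{\Delta}(i,j)$ is a triangle-free graph on $R_k^{\Delta}(i,j)-1$ vertices containing neither a $k$-dense set of $i$ vertices nor a $k$-sparse set of $j$ vertices. *)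

theory Defs
  imports "Graph_Theory.Graph_Theory"
begin

text \<open>
  A finite simple graph is a \<open>pair_graph\<close>: a finite, loop-free digraph whose arc relation
  \<open>parcs\<close> is symmetric. The graph with no vertices is allowed.
\<close>

definition triangle_free :: "'a pair_pre_digraph \<Rightarrow> bool" where
  "triangle_free G \<longleftrightarrow>
    \<not> (\<exists>u v w. (u, v) \<in> parcs G \<and> (v, w) \<in> parcs G \<and> (w, u) \<in> parcs G)"

text \<open>
  In a symmetric digraph without parallel arcs, the out-degree of a vertex is its degree in the
  underlying undirected graph.
\<close>

definition sparse_set :: "nat \<Rightarrow> 'a pair_pre_digraph \<Rightarrow> 'a set \<Rightarrow> bool" where
  "sparse_set k G S \<longleftrightarrow>
    S \<subseteq> pverts G \<and> (\<forall>v\<in>S. out_degree (with_proj G \<restriction> S) v \<le> k)"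

definition dense_set :: "nat \<Rightarrow> 'a pair_pre_digraph \<Rightarrow> 'a set \<Rightarrow> bool" where
  "dense_set k G S \<longleftrightarrow>
    S \<subseteq> pverts G \<and> (\<forall>v\<in>S. card {u\<in>S. u \<noteq> v \<and> (v, u) \<notin> parcs G} \<le> k)"

definition has_dense_or_sparse :: "nat \<Rightarrow> nat \<Rightarrow> nat \<Rightarrow> 'a pair_pre_digraph \<Rightarrow> bool" where
  "has_dense_or_sparse k i j G \<longleftrightarrow>
    (\<exists>S. dense_set k G S \<and> card S = i) \<or> (\<exists>S. sparse_set k G S \<and> card S = j)"

text \<open>
  Vertices are taken in \<open>nat\<close>, since a definition cannot quantify over all vertex types;
  every finite graph is isomorphic to one of this kind.
\<close>

definition ramsey_triangle_free :: "nat \<Rightarrow> nat \<Rightarrow> nat \<Rightarrow> nat" where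
  "ramsey_triangle_free k i j =
    (LEAST n. \<forall>G :: nat pair_pre_digraph.
       pair_graph G \<and> triangle_free G \<and> card (pverts G) = n \<longrightarrow> has_dense_or_sparse k i j G)"

definition extremal_graph :: "nat \<Rightarrow> nat \<Rightarrow> nat \<Rightarrow> 'a pair_pre_digraph \<Rightarrow> bool" where
  "extremal_graph k i j G \<longleftrightarrow>
    pair_graph G \<and> triangle_free G \<and> card (pverts G) + 1 = ramsey_triangle_free k i j \<and>
    \<not> has_dense_or_sparse k i j G"

text \<open>This is the cycle on \<open>n\<close> vertices for \<open>n \<ge> 3\<close>.\<close>

definition cycle_graph :: "nat \<Rightarrow> nat pair_pre_digraph" where
  "cycle_graph n = \<lparr> pverts = {..<n},
     parcs = {(u, v). u < n \<and> v < n \<and> (v = (u + 1) mod n \<or> u = (v + 1) mod n)} \<rparr>"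

end

theory Submission
  imports Defs
begin

text \<open>
  In a triangle-free graph a 4-set is 1-dense iff it carries a 4-cycle, and it is 1-sparse iff the
  complement graph has one on it. If there is no such set, neither the graph
  nor its complement has a 4-cycle, and every 4-set contains a path on three vertices. Degree three is excluded, because the
  three neighbours of a vertex are independent and any further vertex sees at most one of them; so
  on five vertices such a path closes up to a 5-cycle. A sixth vertex would see at most one vertex
  of the 5-cycle, which yields a 1-sparse 4-set.
\<close>

section \<open>Triangle-free graphs with no 4-cycle in the graph or its complement\<close>

text \<open>Loops are excluded by \<open>no_triangle\<close> with u = v = w. Permuting a, b, c, d in
  the last two assumptions covers all three 4-cycles on a 4-set.\<close>

locale c4_free_triangle_free =
  fixes V :: "'a set" and E :: "'a \<Rightarrow> 'a \<Rightarrow> bool"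
  assumes sym: "E u v \<Longrightarrow> E v u"
    and no_triangle: "\<not> (E u v \<and> E v w \<and> E w u)"
    and no_C4: "distinct [a, b, c, d] \<Longrightarrow> {a, b, c, d} \<subseteq> V \<Longrightarrow>
      \<not> (E a b \<and> E b c \<and> E c d \<and> E d a)"
    and no_co_C4: "distinct [a, b, c, d] \<Longrightarrow> {a, b, c, d} \<subseteq> V \<Longrightarrow>
      E a b \<or> E b c \<or> E c d \<or> E d a"
begin

lemma adj_commute: "E u v \<longleftrightarrow> E v u"
  using sym by blast

lemma not_adj_common_neighbour: "E u v \<Longrightarrow> E v w \<Longrightarrow> \<not> E u w"
  using sym no_triangle by blast

text \<open>The fifth vertex d is essential: a star with three leaves has no triangle, and neither
  it nor its complement has a 4-cycle.\<close>

lemma max_degree_2: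
  assumes "distinct [v, a, b, c, d]" "{v, a, b, c, d} \<subseteq> V" "E v a" "E v b"
  shows "\<not> E v c"
proof
  assume "E v c"
  have "\<not> E a b" "\<not> E b c" "\<not> E a c"
    using assms \<open>E v c\<close> not_adj_common_neighbour adj_commute by metis+
  moreover have "\<not> (E d a \<and> E d b)" "\<not> (E d b \<and> E d c)" "\<not> (E d a \<and> E d c)"
    using assms \<open>E v c\<close> no_C4[of v a d b] no_C4[of v b d c] no_C4[of v a d c]
    by (auto simp: adj_commute)
  \<comment> \<open>As a, b, c are independent, each of the three cyclic orders forces d to be
    adjacent to one of two leaves. Every pair of leaves occurs, so d sees two leaves and closes a
    4-cycle through v.\<close>
  ultimately show False
    using assms no_co_C4[of d a b c] no_co_C4[of d a c b] no_co_C4[of d b a c]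
    by (auto simp: adj_commute)
qed

text \<open>Otherwise the edges inside the 4-set form a matching, and one of the three 4-cycles on
  the set avoids any given matching, so it lies in the complement.\<close>

lemma path_in_4_set:
  assumes "distinct [a, b, c, d]" "{a, b, c, d} \<subseteq> V"
  obtains p q r where "distinct [p, q, r]" "{p, q, r} \<subseteq> {a, b, c, d}" "E p q" "E q r"
proof (rule ccontr)
  note path = that
  assume *: "\<not> thesis"
  have "\<not> (E p q \<and> E q r)" if "distinct [p, q, r]" "{p, q, r} \<subseteq> {a, b, c, d}" for p q r
    using * path that by blast
  \<comment> \<open>The twelve instances are the four possible middle vertices with the three pairs
    of ends for each.\<close>
  from this[of a b c] this[of a b d] this[of b a c] this[of b a d] this[of c a d] this[of c b d]
    this[of a c b] this[of a c d] this[of b c d] this[of a d b] this[of a d c] this[of b d c]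
  show False
    using assms no_co_C4[of a b c d] no_co_C4[of a b d c] no_co_C4[of a c b d]
    by (simp add: adj_commute) metis
qed

text \<open>Edges a-d and b-e would close 4-cycles and b-d a triangle. So a-d-b-e is a path of the
  complement, and only an edge between e and a keeps it from closing to a 4-cycle there.\<close>

lemma path5_closes:
  assumes "distinct [a, b, c, d, e]" "{a, b, c, d, e} \<subseteq> V" "E a b" "E b c" "E c d" "E d e"
  shows "E e a"
proof -
  have "\<not> E a d" "\<not> E b d" "\<not> E b e"
    using assms no_C4[of a b c d] no_triangle[of b c d] no_C4[of b c d e]
    by (auto simp: adj_commute)
  then show ?thesis
    using assms no_co_C4[of a d b e] by (auto simp: adj_commute)
qed

lemma five_cycle:
  assumes "W \<subseteq> V" "card W = 5"
  obtains a b c d e where "distinct [a, b, c, d, e]" "W = {a, b, c, d, e}"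
    "E a b" "E b c" "E c d" "E d e" "E e a"
proof -
  note * = that
  have "finite W" using assms(2) card.infinite by fastforce
  obtain T where "T \<subseteq> W" "card T = 4"
    using assms(2) obtain_subset_with_card_n[of 4 W] by auto
  obtain xs where "distinct xs" "set xs = T" "length xs = 4"
    using \<open>card T = 4\<close> \<open>T \<subseteq> W\<close> \<open>finite W\<close>
    by (metis distinct_card finite_distinct_list finite_subset)
  then obtain x1 x2 x3 x4 where "T = {x1, x2, x3, x4}" "distinct [x1, x2, x3, x4]"
    by (auto simp: numeral_eq_Suc length_Suc_conv)
  then obtain p q r where pqr: "distinct [p, q, r]" "{p, q, r} \<subseteq> T" "E p q" "E q r"
    using path_in_4_set[of x1 x2 x3 x4] \<open>T \<subseteq> W\<close> \<open>W \<subseteq> V\<close>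
    by (metis (no_types) subset_trans)
  have "card (W - {p, q, r}) = 2"
    using pqr \<open>T \<subseteq> W\<close> \<open>finite W\<close> assms by (subst card_Diff_subset) auto
  then obtain s t where st: "W - {p, q, r} = {s, t}" "s \<noteq> t"
    by (auto simp: card_2_iff)
  then have W: "W = {p, q, r, s, t}" and dist: "distinct [p, q, r, s, t]"
    using pqr \<open>T \<subseteq> W\<close> by auto
  have sub: "{p, q, r, s, t} \<subseteq> V" using W assms by simp
  have "\<not> E p r" using pqr not_adj_common_neighbour by blast
  have q: "\<not> E q s" "\<not> E q t"
    using max_degree_2[of q p r s t] max_degree_2[of q p r t s] dist sub pqr
    by (auto simp: adj_commute)
  have p: "\<not> (E p s \<and> E p t)" and r: "\<not> (E r s \<and> E r t)"
    using max_degree_2[of p s t q r] max_degree_2[of r s t q p] dist sub pqr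
    by (auto simp: adj_commute)
  have s: "\<not> (E p s \<and> E r s)" and t: "\<not> (E p t \<and> E r t)"
    using no_C4[of p q r s] no_C4[of p q r t] dist sub pqr
    by (auto simp: adj_commute)
  \<comment> \<open>The edges between {p, r} and {s, t} form a matching by the four preceding facts.
    The cyclic order p, s, r, t shows that it is nonempty; the other two orders then force the edge
    s-t.\<close>
  have "E s t" and "E p s \<or> E p t \<or> E r s \<or> E r t"
    using \<open>\<not> E p r\<close> p r s t dist sub
      no_co_C4[of p r s t] no_co_C4[of p s r t] no_co_C4[of p r t s]
    by (auto simp: adj_commute)
  then have ends: "E t s \<and> E s p \<or> E s t \<and> E t p \<or> E t s \<and> E s r \<or> E s t \<and> E t r"
    using sym by blast
  \<comment> \<open>The path p-q-r extends to a path on five vertices at either end, through s or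
    through t. Generalizing over p, r, s, t lets one argument serve all four cases.\<close>
  have close: thesis
    if "distinct [t, s, p, q, r]" "W = {t, s, p, q, r}" "E t s" "E s p" "E p q" "E q r"
    for p r s t
    using that path5_closes[of t s p q r] \<open>W \<subseteq> V\<close> by (intro *[of t s p q r]) simp_all
  have "E q p" "E r q" using pqr sym by blast+
  moreover have "W = {t, s, p, q, r}" "W = {s, t, p, q, r}" "W = {t, s, r, q, p}"
    "W = {s, t, r, q, p}"
    using W by auto
  moreover have "distinct [t, s, p, q, r]" "distinct [s, t, p, q, r]" "distinct [t, s, r, q, p]"
    "distinct [s, t, r, q, p]"
    using dist by auto
  ultimately show thesis
    using ends pqr(3,4) close[of t s p r] close[of s t p r] close[of t s r p] close[of s t r p]
    by blast
qed

lemma five_cycle_spanning: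
  assumes "distinct [a, b, c, d, e]" "{a, b, c, d, e} \<subseteq> V"
    and "E a b" "E b c" "E c d" "E d e" "E e a"
  shows "V = {a, b, c, d, e}"
proof (rule ccontr)
  assume "V \<noteq> {a, b, c, d, e}"
  then obtain x where x: "x \<in> V" "x \<notin> {a, b, c, d, e}" using assms by blast
  have nonadj: "\<not> E a c" "\<not> E a d" "\<not> E b d" "\<not> E b e" "\<not> E c e"
    using assms not_adj_common_neighbour adj_commute by metis+
  have "\<not> (E x a \<and> E x b)" "\<not> (E x b \<and> E x c)" "\<not> (E x c \<and> E x d)"
    "\<not> (E x d \<and> E x e)" "\<not> (E x e \<and> E x a)"
    using assms not_adj_common_neighbour adj_commute by metis+
  moreover have "\<not> (E x a \<and> E x c)" "\<not> (E x b \<and> E x d)" "\<not> (E x c \<and> E x e)"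
    "\<not> (E x d \<and> E x a)" "\<not> (E x e \<and> E x b)"
    using assms x no_C4[of x a b c] no_C4[of x b c d] no_C4[of x c d e]
      no_C4[of x d e a] no_C4[of x e a b]
    by (auto simp: adj_commute)
  \<comment> \<open>Two consecutive chords of the 5-cycle form a path of the complement, which x
    would close to a 4-cycle unless x sees one of its ends. No vertex lies in all three pairs of
    ends, so x has two neighbours on the cycle.\<close>
  moreover have "E x d \<or> E x e" "E x e \<or> E x a" "E x a \<or> E x b"
    using nonadj assms(1,2) x no_co_C4[of x d b e] no_co_C4[of x e c a] no_co_C4[of x a d b]
    by (auto simp: adj_commute)
  ultimately show False by blast
qed

end

section \<open>From dense and sparse 4-sets to 4-cycles\<close>

lemma out_degree_induced:
  assumes "v \<in> S"
  shows "out_degree (with_proj G \<restriction> S) v = card {u \<in> S. (v, u) \<in> parcs G}"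
proof -
  have "out_arcs (with_proj G \<restriction> S) v = Pair v ` {u \<in> S. (v, u) \<in> parcs G}"
    using assms by (auto simp: out_arcs_def)
  then show ?thesis by (simp add: out_degree_def card_image inj_on_def)
qed

text \<open>On a 4-cycle a vertex can be non-adjacent only to the opposite one, which makes the
  4-set 1-dense. On a 4-cycle of the complement it can be adjacent only to the opposite one, which
  makes the set 1-sparse.\<close>

lemma c4_free_triangle_free_if_not_has_dense_or_sparse:
  assumes "pair_graph G" "triangle_free G" "\<not> has_dense_or_sparse 1 4 4 G"
  shows "c4_free_triangle_free (pverts G) (\<lambda>u v. (u, v) \<in> parcs G)"
proof -
  interpret pair_graph G by fact
  have le1: "card A \<le> 1" if "A \<subseteq> {x}" for A :: "'a set" and x
    using card_mono[of "{x}" A] that by simp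
  show ?thesis
  proof
    fix a b c d :: 'a
    assume dist: "distinct [a, b, c, d]" and sub: "{a, b, c, d} \<subseteq> pverts G"
    have card: "card {a, b, c, d} = 4" using dist by simp
    show "\<not> ((a, b) \<in> parcs G \<and> (b, c) \<in> parcs G \<and> (c, d) \<in> parcs G \<and> (d, a) \<in> parcs G)"
    proof
      assume *: "(a, b) \<in> parcs G \<and> (b, c) \<in> parcs G \<and> (c, d) \<in> parcs G \<and> (d, a) \<in> parcs G"
      then have "(b, a) \<in> parcs G" "(c, b) \<in> parcs G" "(d, c) \<in> parcs G" "(a, d) \<in> parcs G"
        by (auto intro: arcs_symmetric)
      with * have "card {u \<in> {a, b, c, d}. u \<noteq> a \<and> (a, u) \<notin> parcs G} \<le> 1"
        "card {u \<in> {a, b, c, d}. u \<noteq> b \<and> (b, u) \<notin> parcs G} \<le> 1"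
        "card {u \<in> {a, b, c, d}. u \<noteq> c \<and> (c, u) \<notin> parcs G} \<le> 1"
        "card {u \<in> {a, b, c, d}. u \<noteq> d \<and> (d, u) \<notin> parcs G} \<le> 1"
        by (intro le1[of _ c] le1[of _ d] le1[of _ a] le1[of _ b]; blast)+
      then have "dense_set 1 G {a, b, c, d}"
        using sub by (simp only: dense_set_def ball_simps simp_thms)
      then show False using assms(3) card unfolding has_dense_or_sparse_def by blast
    qed
    show "(a, b) \<in> parcs G \<or> (b, c) \<in> parcs G \<or> (c, d) \<in> parcs G \<or> (d, a) \<in> parcs G"
    proof (rule ccontr)
      assume *: "\<not> ?thesis"
      then have "(b, a) \<notin> parcs G" "(c, b) \<notin> parcs G" "(d, c) \<notin> parcs G" "(a, d) \<notin> parcs G"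
        by (auto dest: arcs_symmetric)
      moreover have "(v, v) \<notin> parcs G" for v using no_loops' by blast
      ultimately have "card {u \<in> {a, b, c, d}. (a, u) \<in> parcs G} \<le> 1"
        "card {u \<in> {a, b, c, d}. (b, u) \<in> parcs G} \<le> 1"
        "card {u \<in> {a, b, c, d}. (c, u) \<in> parcs G} \<le> 1"
        "card {u \<in> {a, b, c, d}. (d, u) \<in> parcs G} \<le> 1"
        using * by (intro le1[of _ c] le1[of _ d] le1[of _ a] le1[of _ b]; blast)+
      then have "sparse_set 1 G {a, b, c, d}"
        using sub
        by (simp only: sparse_set_def ball_simps out_degree_induced insertI1 insertI2 simp_thms)
      then show False using assms(3) card unfolding has_dense_or_sparse_def by blast
    qed
  next
    show "(v, u) \<in> parcs G" if "(u, v) \<in> parcs G" for u v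
      using that by (rule arcs_symmetric)
    show "\<not> ((u, v) \<in> parcs G \<and> (v, w) \<in> parcs G \<and> (w, u) \<in> parcs G)" for u v w
      using assms(2) unfolding triangle_free_def by blast
  qed
qed

section \<open>Upper bound\<close>

text \<open>Any five of the six vertices would carry a 5-cycle, which leaves no room for a sixth
  vertex.\<close>

lemma has_dense_or_sparse_on_6_vertices:
  assumes "pair_graph G" "triangle_free G" "card (pverts G) = 6"
  shows "has_dense_or_sparse 1 4 4 G"
proof (rule ccontr)
  assume "\<not> has_dense_or_sparse 1 4 4 G"
  then interpret c4_free_triangle_free "pverts G" "\<lambda>u v. (u, v) \<in> parcs G"
    using c4_free_triangle_free_if_not_has_dense_or_sparse assms by blast
  obtain W where W: "W \<subseteq> pverts G" "card W = 5"
    using assms(3) obtain_subset_with_card_n[of 5 "pverts G"] by auto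
  obtain a b c d e where "distinct [a, b, c, d, e]" "W = {a, b, c, d, e}"
    "(a, b) \<in> parcs G" "(b, c) \<in> parcs G" "(c, d) \<in> parcs G" "(d, e) \<in> parcs G"
    "(e, a) \<in> parcs G"
    using five_cycle[OF W] .
  then have "pverts G = W"
    using five_cycle_spanning[of a b c d e] W by simp
  then show False using W assms(3) by simp
qed

section \<open>Lower bound: the 5-cycle and its induced subgraphs\<close>

text \<open>
  The least-number definition needs a counterexample of every order below 6; induced subgraphs of
  the 5-cycle serve for all of them.
\<close>

definition cycle5_part :: "nat \<Rightarrow> nat pair_pre_digraph" where
  "cycle5_part n = \<lparr>pverts = {..<n}, parcs = parcs (cycle_graph 5) \<inter> {..<n} \<times> {..<n}\<rparr>"

text \<open>The explicit list replaces arithmetic modulo 5 by finite case checks.\<close>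

lemma parcs_cycle_graph_5:
  "parcs (cycle_graph 5) =
    {(0, 1), (1, 2), (2, 3), (3, 4), (4, 0), (1, 0), (2, 1), (3, 2), (4, 3), (0, 4)}"
  (is "_ = ?A")
proof -
  have five: "u = 0 \<or> u = 1 \<or> u = 2 \<or> u = 3 \<or> u = 4" if "u < 5" for u :: nat
    using that by auto
  show ?thesis
  proof (intro equalityI subrelI)
    fix u v
    assume "(u, v) \<in> parcs (cycle_graph 5)"
    then have "u < 5" "v < 5" and adj: "v = (u + 1) mod 5 \<or> u = (v + 1) mod 5"
      by (simp_all add: cycle_graph_def)
    from five[OF \<open>u < 5\<close>] five[OF \<open>v < 5\<close>] adj show "(u, v) \<in> ?A"
      by (elim disjE) simp_all
  qed (auto simp: cycle_graph_def)
qed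

lemma cycle_graph_5_eq: "cycle_graph 5 = cycle5_part 5"
proof (rule pair_pre_digraph.equality)
  have "parcs (cycle_graph 5) \<subseteq> {..<5} \<times> {..<5}"
    by (simp add: parcs_cycle_graph_5)
  then show "parcs (cycle_graph 5) = parcs (cycle5_part 5)"
    by (simp add: cycle5_part_def Int_absorb2)
qed (simp_all add: cycle5_part_def cycle_graph_def)

lemma pair_graph_cycle5_part: "pair_graph (cycle5_part n)"
proof unfold_locales
  have "parcs (cycle5_part n) = (parcs (cycle5_part n))\<inverse>"
    unfolding cycle5_part_def cycle_graph_def by auto
  then show "symmetric (with_proj (cycle5_part n))"
    by (simp add: symmetric_def sym_conv_converse_eq)
qed (auto simp: cycle5_part_def parcs_cycle_graph_5)

lemma triangle_free_cycle5_part: "triangle_free (cycle5_part n)"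
proof -
  \<comment> \<open>Along an arc the vertex number changes by 1 or 4 in absolute value, and three
    such changes never sum to zero.\<close>
  have arc: "v = u + 1 \<or> u = v + 1 \<or> u = 0 \<and> v = 4 \<or> u = 4 \<and> v = 0"
    if "(u, v) \<in> parcs (cycle5_part n)" for u v
    using that by (auto simp: cycle5_part_def parcs_cycle_graph_5)
  have False if "(u, v) \<in> parcs (cycle5_part n)" "(v, w) \<in> parcs (cycle5_part n)"
    "(w, u) \<in> parcs (cycle5_part n)" for u v w
    using that[THEN arc] by auto
  then show ?thesis unfolding triangle_free_def by blast
qed

lemma four_subset_of_lessThan_5:
  assumes "S \<subseteq> {..<5::nat}" "card S = 4"
  shows "S \<in> {{1, 2, 3, 4}, {0, 2, 3, 4}, {0, 1, 3, 4}, {0, 1, 2, 4}, {0, 1, 2, 3}}"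
proof -
  have "card ({..<5} - S) = 1"
    using assms finite_subset[OF assms(1)] by (subst card_Diff_subset) auto
  then obtain x where "{..<5} - S = {x}" by (auto simp: card_1_singleton_iff)
  then have "S = {..<5} - {x}" "x < 5" using assms by auto
  moreover have "{..<5::nat} = {0, 1, 2, 3, 4}" by auto
  ultimately show ?thesis by (auto simp: numeral_eq_Suc less_Suc_eq)
qed

lemma not_has_dense_or_sparse_cycle5_part:
  assumes "n \<le> 5"
  shows "\<not> has_dense_or_sparse 1 4 4 (cycle5_part n)"
proof
  assume "has_dense_or_sparse 1 4 4 (cycle5_part n)"
  then obtain S where S: "card S = 4"
    and or: "dense_set 1 (cycle5_part n) S \<or> sparse_set 1 (cycle5_part n) S"
    unfolding has_dense_or_sparse_def by blast
  have sub: "S \<subseteq> {..<n}"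
    using or by (auto simp: dense_set_def sparse_set_def cycle5_part_def)
  then have "S \<subseteq> {..<5}" using assms by auto
  then have cases: "S \<in> {{1, 2, 3, 4}, {0, 2, 3, 4}, {0, 1, 3, 4}, {0, 1, 2, 4}, {0, 1, 2, 3}}"
    using S by (rule four_subset_of_lessThan_5)
  have arcs: "(v, u) \<in> parcs (cycle5_part n) \<longleftrightarrow> (v, u) \<in> parcs (cycle_graph 5)"
    if "v \<in> S" "u \<in> S" for u v
    using that sub by (auto simp: cycle5_part_def)
  \<comment> \<open>The inclusion in S makes A finite; \<open>card\<close> is 0 on infinite
    sets.\<close>
  have two: False if "card A \<le> 1" "{x, y} \<subseteq> A" "x \<noteq> y" "A \<subseteq> S" for A and x y :: nat
    using that card_mono[of A "{x, y}"] sub by (simp add: finite_subset)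
  from or show False
  proof
    assume "dense_set 1 (cycle5_part n) S"
    then have le: "card {u \<in> S. u \<noteq> v \<and> (v, u) \<notin> parcs (cycle5_part n)} \<le> 1" if "v \<in> S" for v
      using that by (simp add: dense_set_def)
    have dense: "(v, x) \<in> parcs (cycle_graph 5) \<or> (v, y) \<in> parcs (cycle_graph 5)"
      if "v \<in> S" "x \<in> S" "y \<in> S" "distinct [v, x, y]" for v x y
      using two[OF le[OF that(1)], of x y] that arcs by auto
    \<comment> \<open>Each vertex is taken with its two non-neighbours on the 5-cycle. S omits one
      vertex of the cycle, and a neighbour of that vertex has both its non-neighbours in S.\<close>
    show False
      using cases
        dense[of 1 3 4] dense[of 2 4 0] dense[of 3 0 1] dense[of 4 1 2] dense[of 0 2 3]
      by (auto simp: parcs_cycle_graph_5)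
  next
    assume "sparse_set 1 (cycle5_part n) S"
    then have le: "card {u \<in> S. (v, u) \<in> parcs (cycle5_part n)} \<le> 1" if "v \<in> S" for v
      using that by (simp add: sparse_set_def out_degree_induced)
    have sparse: "(v, x) \<notin> parcs (cycle_graph 5) \<or> (v, y) \<notin> parcs (cycle_graph 5)"
      if "v \<in> S" "x \<in> S" "y \<in> S" "x \<noteq> y" for v x y
      using two[OF le[OF that(1)], of x y] that arcs by auto
    \<comment> \<open>Now each vertex is taken with its two neighbours. A vertex not adjacent to the
      omitted one has both its neighbours in S.\<close>
    show False
      using cases
        sparse[of 1 0 2] sparse[of 2 1 3] sparse[of 3 2 4] sparse[of 4 3 0] sparse[of 0 4 1]
      by (auto simp: parcs_cycle_graph_5)
  qed
qed

lemma ramsey_triangle_free_1_4_4: "ramsey_triangle_free 1 4 4 = 6"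
  unfolding ramsey_triangle_free_def
proof (rule Least_equality)
  fix n
  assume *: "\<forall>G :: nat pair_pre_digraph.
    pair_graph G \<and> triangle_free G \<and> card (pverts G) = n \<longrightarrow> has_dense_or_sparse 1 4 4 G"
  have "card (pverts (cycle5_part n)) = n" by (simp add: cycle5_part_def)
  then have "\<not> n \<le> 5"
    using * pair_graph_cycle5_part triangle_free_cycle5_part
      not_has_dense_or_sparse_cycle5_part by blast
  then show "6 \<le> n" by simp
qed (intro allI impI; elim conjE; rule has_dense_or_sparse_on_6_vertices)

section \<open>Uniqueness of the extremal graph\<close>

text \<open>Arcs are pairs of vertices, so the vertex map f determines the arc map
  \<open>map_prod f f\<close>, and tail and head remain the projections. The arc map is injective
  because all arcs join vertices of G.\<close>

lemma digraph_iso_with_projI: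
  assumes "wf_digraph (with_proj G)" "inj_on f (pverts G)" "f ` pverts G = pverts H"
    and "map_prod f f ` parcs G = parcs H"
  shows "digraph_iso (with_proj G) (with_proj H)"
proof -
  have "inj_on (map_prod f f) (parcs G)"
  proof (rule inj_on_subset)
    show "inj_on (map_prod f f) (pverts G \<times> pverts G)"
      using assms(2) by (intro map_prod_inj_on)
    show "parcs G \<subseteq> pverts G \<times> pverts G"
      using assms(1) by (auto simp: wf_digraph_wp_iff pair_wf_digraph_def)
  qed
  then have "pre_digraph.digraph_isomorphism (with_proj G)
      \<lparr>iso_verts = f, iso_arcs = map_prod f f, iso_head = snd, iso_tail = fst\<rparr>"
    using assms by (simp add: pre_digraph.digraph_isomorphism_def)
  moreover have "with_proj H = app_iso
      \<lparr>iso_verts = f, iso_arcs = map_prod f f, iso_head = snd, iso_tail = fst\<rparr> (with_proj G)"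
    using assms by (simp add: app_iso_def with_proj_def)
  ultimately show ?thesis unfolding digraph_iso_def by blast
qed

text \<open>With five vertices in total, the 5-cycle from \<open>five_cycle\<close> spans G. Each
  chord would join two vertices with a common neighbour on the cycle and create a triangle, so G has
  no further arcs and numbering along the cycle is an isomorphism.\<close>

lemma extremal_graph_iso_cycle_graph_5:
  assumes "extremal_graph 1 4 4 G"
  shows "digraph_iso (with_proj G) (with_proj (cycle_graph 5))"
proof -
  interpret pair_graph G using assms by (simp add: extremal_graph_def)
  interpret c4_free_triangle_free "pverts G" "\<lambda>u v. (u, v) \<in> parcs G"
    by (rule c4_free_triangle_free_if_not_has_dense_or_sparse)
      (use assms in \<open>simp_all add: extremal_graph_def\<close>)
  have "card (pverts G) = 5"
    using assms unfolding extremal_graph_def ramsey_triangle_free_1_4_4 by simp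
  then obtain a b c d e where dist: "distinct [a, b, c, d, e]" and V: "pverts G = {a, b, c, d, e}"
    and cyc: "(a, b) \<in> parcs G" "(b, c) \<in> parcs G" "(c, d) \<in> parcs G" "(d, e) \<in> parcs G"
      "(e, a) \<in> parcs G"
    by (rule five_cycle[OF order_refl])
  have nonadj: "(a, c) \<notin> parcs G" "(a, d) \<notin> parcs G" "(b, d) \<notin> parcs G" "(b, e) \<notin> parcs G"
    "(c, e) \<notin> parcs G" "(c, a) \<notin> parcs G" "(d, a) \<notin> parcs G" "(d, b) \<notin> parcs G"
    "(e, b) \<notin> parcs G" "(e, c) \<notin> parcs G"
    using cyc not_adj_common_neighbour adj_commute by metis+
  have loops: "(v, v) \<notin> parcs G" for v using no_loops' by blast
  have arcs: "parcs G = {(a, b), (b, c), (c, d), (d, e), (e, a),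
      (b, a), (c, b), (d, c), (e, d), (a, e)}" (is "_ = ?A")
  proof (intro equalityI subrelI)
    fix u v
    assume *: "(u, v) \<in> parcs G"
    then have "u \<in> {a, b, c, d, e}" "v \<in> {a, b, c, d, e}" using V wellformed' by blast+
    then show "(u, v) \<in> ?A"
      using * nonadj loops by (elim insertE emptyE) simp_all
  qed (use cyc cyc[THEN sym] in auto)
  define f where "f = (\<lambda>x. if x = a then 0 else if x = b then 1 else if x = c then 2
    else if x = d then 3 else (4::nat))"
  have f: "f a = 0" "f b = 1" "f c = 2" "f d = 3" "f e = 4"
    using dist by (auto simp: f_def)
  show ?thesis
  proof (rule digraph_iso_with_projI)
    show "wf_digraph (with_proj G)" by unfold_locales
    show "inj_on f (pverts G)" using f by (auto simp: V)
    show "f ` pverts G = pverts (cycle_graph 5)" using f by (auto simp: V cycle_graph_def)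
    show "map_prod f f ` parcs G = parcs (cycle_graph 5)"
      using f by (simp add: arcs parcs_cycle_graph_5)
  qed
qed

theorem theorem4p1:
  shows "ramsey_triangle_free 1 4 4 = 6 \<and>
    (\<forall>G :: 'a pair_pre_digraph.
       pair_graph G \<and> triangle_free G \<and> card (pverts G) = 6 \<longrightarrow> has_dense_or_sparse 1 4 4 G) \<and>
    extremal_graph 1 4 4 (cycle_graph 5) \<and>
    (\<forall>G :: 'a pair_pre_digraph.
       extremal_graph 1 4 4 G \<longrightarrow> digraph_iso (with_proj G) (with_proj (cycle_graph 5)))"
proof (intro conjI allI impI; (elim conjE)?)
  have "card (pverts (cycle5_part 5)) + 1 = 6" by (simp add: cycle5_part_def)
  then show "extremal_graph 1 4 4 (cycle_graph 5)"
    unfolding extremal_graph_def ramsey_triangle_free_1_4_4 cycle_graph_5_eq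
    using pair_graph_cycle5_part triangle_free_cycle5_part
      not_has_dense_or_sparse_cycle5_part[OF order_refl] by simp
qed (rule ramsey_triangle_free_1_4_4 has_dense_or_sparse_on_6_vertices
    extremal_graph_iso_cycle_graph_5; assumption)+

end
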